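(* Let $m,n\ge 1$ and consider the complete bipartite graph $K_{m,n}$, properly two-colored (one part one color, the other part the other color). The \textsc{flag coloring} position on $K_{m,n}$ is a $\mathcal{P}$-position if and only if $m\ge 2$ and $n\ge 2$.
   Context: \textsc{flag coloring} is an impartial two-player game played on a simple graph whose vertices are colored. A move consists of choosing a vertex $v$, of color $c$ say, and a color $c'\neq c$ that is the color of some vertex adjacent to $v$; then $v$ and every vertex of the connected component of the subgraph induced by color-$c$ vertices that contains $v$ are recolored $c'$. Play is under the normal play convention: a player unable to move loses. A position is a $\mathcal{P}$-position if the player to move has no winning strategy (equivalently, its Sprague–Grundy value is $0$), and an $\mathcal{N}$-position otherwise. *)

theory Defs
  imports "Graph_Theory.Graph_Theory"
begin

section \<open>Impartial games under normal play\<close>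

text \<open>
  A game is given by its move relation on positions, and a strategy \<open>\<sigma>\<close> maps a position to the
  position its owner moves to. The strategy wins from \<open>p\<close> for the player to move if it makes a legal
  move there and still wins after every reply of the opponent. The least fixed point forces every
  play consistent with \<open>\<sigma>\<close> to be finite; such a play ends with the opponent unable to move.
\<close>

inductive winning_strategy :: "('p \<Rightarrow> 'p \<Rightarrow> bool) \<Rightarrow> ('p \<Rightarrow> 'p) \<Rightarrow> 'p \<Rightarrow> bool"
  for move :: "'p \<Rightarrow> 'p \<Rightarrow> bool" and \<sigma> :: "'p \<Rightarrow> 'p"
  where
    "move p (\<sigma> p) \<Longrightarrow> (\<And>q. move (\<sigma> p) q \<Longrightarrow> winning_strategy move \<sigma> q)
      \<Longrightarrow> winning_strategy move \<sigma> p"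

definition P_position :: "('p \<Rightarrow> 'p \<Rightarrow> bool) \<Rightarrow> 'p \<Rightarrow> bool" where
  "P_position move p \<longleftrightarrow> \<not> (\<exists>\<sigma>. winning_strategy move \<sigma> p)"


section \<open>Flag Coloring\<close>

text \<open>
  As usual in the library, a simple graph is a symmetric digraph without loops and multiple arcs
  (locale \<open>graph\<close>). A coloring is a function on the whole vertex type, of which only the values on
  \<open>verts G\<close> matter; moves leave the other values unchanged.
\<close>

definition color_component :: "('a, 'b) pre_digraph \<Rightarrow> ('a \<Rightarrow> 'c) \<Rightarrow> 'a \<Rightarrow> 'a set" where
  "color_component G f v = {u. v \<rightarrow>\<^sup>*\<^bsub>G \<restriction> {w \<in> verts G. f w = f v}\<^esub> u}"

definition flag_move :: "('a, 'b) pre_digraph \<Rightarrow> ('a \<Rightarrow> 'c) \<Rightarrow> ('a \<Rightarrow> 'c) \<Rightarrow> bool" where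
  "flag_move G f g \<longleftrightarrow>
    (\<exists>v \<in> verts G. \<exists>c'. c' \<noteq> f v \<and> (\<exists>w. v \<rightarrow>\<^bsub>G\<^esub> w \<and> f w = c') \<and>
      g = (\<lambda>u. if u \<in> color_component G f v then c' else f u))"

text \<open>
  On a connected bipartite graph with at least one edge, the following says that one part has one
  color and the other part another color.
\<close>

definition properly_two_colored :: "('a, 'b) pre_digraph \<Rightarrow> ('a \<Rightarrow> 'c) \<Rightarrow> bool" where
  "properly_two_colored G f \<longleftrightarrow>
    card (f ` verts G) = 2 \<and> (\<forall>u v. u \<rightarrow>\<^bsub>G\<^esub> v \<longrightarrow> f u \<noteq> f v)"

end

theory Submission
  imports Defs
begin

text \<open>
  A part with a single vertex can be recolored at once, which makes the graph monochromatic and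
  wins. If both parts have at least two vertices, the first move recolors a single vertex, which
  merges it with the whole opposite part, and the rest of its own part keeps the old color. The
  opponent recolors the merged component with that color and wins.
\<close>

lemma winning_strategy_move:
  "winning_strategy move \<sigma> p \<Longrightarrow> move p (\<sigma> p)"
  by (auto elim: winning_strategy.cases)

text \<open>A winning strategy would also have to win from the reply \<open>r\<close> to its own
  first move, hence have a legal move there; but \<open>r\<close> is terminal. This two-move
  criterion suffices because the second player can always end the game at once.\<close>

lemma P_positionI:
  assumes "\<And>q. move p q \<Longrightarrow> \<exists>r. move q r \<and> (\<forall>s. \<not> move r s)"
  shows "P_position move p"
  unfolding P_position_def
proof
  assume "\<exists>\<sigma>. winning_strategy move \<sigma> p"
  then obtain \<sigma> where "winning_strategy move \<sigma> p" ..
  then show False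
    by cases (metis assms winning_strategy_move)
qed

lemma not_P_positionI:
  assumes "move p q" "\<And>r. \<not> move q r"
  shows "\<not> P_position move p"
proof -
  \<comment> \<open>A constant strategy is enough: after the move to \<open>q\<close> there are no
    replies, so it is never consulted again.\<close>
  have "winning_strategy move (\<lambda>_. q) p"
    by (rule winning_strategy.intros) (use assms in auto)
  then show ?thesis
    unfolding P_position_def by blast
qed

lemma dominates_induce_subgraph_iff:
  "u \<rightarrow>\<^bsub>G \<restriction> S\<^esub> v \<longleftrightarrow> u \<rightarrow>\<^bsub>G\<^esub> v \<and> u \<in> S \<and> v \<in> S"
  by (auto simp: arcs_ends_conv)

lemma color_component_subset:
  "color_component G f v \<subseteq> {w \<in> verts G. f w = f v}"
  unfolding color_component_def by (auto elim: reachable_in_vertsE)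

lemma color_component_refl:
  "v \<in> verts G \<Longrightarrow> v \<in> color_component G f v"
  unfolding color_component_def reachable_def by auto

lemma color_component_step:
  assumes "u \<in> color_component G f v" "u \<rightarrow>\<^bsub>G\<^esub> w" "w \<in> verts G" "f w = f v"
  shows "w \<in> color_component G f v"
proof -
  have "u \<in> verts G" "f u = f v"
    using assms(1) color_component_subset[of G f v] by auto
  then show ?thesis
    using assms unfolding color_component_def reachable_def mem_Collect_eq
    by (elim rtrancl_on_into_rtrancl_on) (simp_all add: dominates_induce_subgraph_iff)
qed

lemma color_component_isolated:
  assumes "v \<in> verts G" "\<And>w. v \<rightarrow>\<^bsub>G\<^esub> w \<Longrightarrow> f w \<noteq> f v"
  shows "color_component G f v = {v}"
proof -
  have "u = v" if "u \<in> color_component G f v" for u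
    using that assms(2) unfolding color_component_def reachable_def mem_Collect_eq
    \<comment> \<open>The first arc of a nontrivial path from \<open>v\<close> would lead to a
      neighbor of the same color.\<close>
    by (cases rule: converse_rtrancl_on_cases) (auto simp: dominates_induce_subgraph_iff)
  then show ?thesis
    using color_component_refl[OF assms(1)] by blast
qed

text \<open>The parts are explicit parameters so that facts proved for moves in \<open>U\<close>
  transfer to \<open>V\<close> by exchanging the two.\<close>

locale complete_bipartite =
  fixes G :: "('a, 'b) pre_digraph" and U V :: "'a set"
  assumes verts_eq: "verts G = U \<union> V"
    and disjoint: "U \<inter> V = {}"
    and arcs_ends_eq: "arcs_ends G = U \<times> V \<union> V \<times> U"
begin

lemma swap: "complete_bipartite G V U"
  using verts_eq disjoint arcs_ends_eq by unfold_locales auto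

lemma no_flag_move_monochromatic:
  assumes "\<And>v. v \<in> verts G \<Longrightarrow> f v = c"
  shows "\<not> flag_move G f g"
  unfolding flag_move_def using assms verts_eq arcs_ends_eq by auto

text \<open>A color class meeting both parts is connected: \<open>v\<close> is adjacent to all of
  \<open>U\<close>, and \<open>u\<close> to all of \<open>V\<close>, so the class is reached from
  \<open>v\<close> directly or through \<open>u\<close>.\<close>

lemma color_component_eq_class:
  assumes "u \<in> U" "v \<in> V" "f u = f v"
  shows "color_component G f v = {w \<in> verts G. f w = f v}"
proof
  have v: "v \<in> color_component G f v"
    using assms(2) verts_eq by (intro color_component_refl) auto
  have *: "w \<in> color_component G f v" if "w \<in> U" "f w = f v" for w
    by (rule color_component_step[OF v]) (use that assms(2) verts_eq arcs_ends_eq in auto)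
  have "w \<in> color_component G f v" if "w \<in> V" "f w = f v" for w
    by (rule color_component_step[OF *[OF assms(1,3)]])
      (use that assms(1) verts_eq arcs_ends_eq in auto)
  with * show "{w \<in> verts G. f w = f v} \<subseteq> color_component G f v"
    using verts_eq by auto
qed (rule color_component_subset)

lemma color_component_singleton:
  assumes "v \<in> U" "f v = a" "\<And>w. w \<in> V \<Longrightarrow> f w = b" "a \<noteq> b"
  shows "color_component G f v = {v}"
  by (rule color_component_isolated) (use assms verts_eq disjoint arcs_ends_eq in auto)

lemma flag_move_singleton:
  assumes "u \<in> U" "f u = a" "v \<in> V" "\<And>w. w \<in> V \<Longrightarrow> f w = b" "a \<noteq> b"
  shows "flag_move G f (f(u := b))"
proof -
  have "color_component G f u = {u}"
    by (rule color_component_singleton) (use assms in auto)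
  then have "f(u := b) = (\<lambda>w. if w \<in> color_component G f u then b else f w)"
    by auto
  then show ?thesis
    unfolding flag_move_def using assms verts_eq arcs_ends_eq
    by (intro bexI[of _ u] exI[of _ b] conjI exI[of _ v]) auto
qed

text \<open>After \<open>x\<close> has taken color \<open>b\<close>, the class of \<open>b\<close>
  meets both parts and is therefore a single component, so one move can turn all of it into
  \<open>a\<close>.\<close>

lemma winning_reply:
  assumes "x \<in> U" "y \<in> U" "x \<noteq> y" "v \<in> V" "a \<noteq> b"
    and "\<And>w. w \<in> U \<Longrightarrow> f w = a" "\<And>w. w \<in> V \<Longrightarrow> f w = b"
  shows "\<exists>r. flag_move G (f(x := b)) r \<and> (\<forall>s. \<not> flag_move G r s)"
proof -
  let ?g = "f(x := b)"
  let ?r = "\<lambda>w. if w \<in> color_component G ?g v then a else ?g w"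
  have g: "?g v = b" "?g x = b" "?g y = a"
    using assms disjoint by auto
  \<comment> \<open>The reply is legal because \<open>y\<close>, a neighbor of \<open>v\<close>,
    still shows color \<open>a\<close>.\<close>
  have "flag_move G ?g ?r"
    unfolding flag_move_def using assms g verts_eq arcs_ends_eq
    by (intro bexI[of _ v] exI[of _ a] conjI exI[of _ y]) auto
  moreover have "color_component G ?g v = {w \<in> verts G. ?g w = b}"
    using color_component_eq_class[of x v ?g] assms g by simp
  \<comment> \<open>Vertices outside the recolored class lie in \<open>U\<close> and have color
    \<open>a\<close> already.\<close>
  then have "?r w = a" if "w \<in> verts G" for w
    using that assms verts_eq by auto
  then have "\<not> flag_move G ?r s" for s
    by (rule no_flag_move_monochromatic)
  ultimately show ?thesis
    by blast
qed

text \<open>All neighbors of \<open>v\<close> have color \<open>b\<close>, so the component of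
  \<open>v\<close> is trivial and \<open>b\<close> is the only color available to it.\<close>

lemma flag_move_from_U:
  assumes "v \<in> U" "v \<rightarrow>\<^bsub>G\<^esub> w" "a \<noteq> b"
    and "\<And>w. w \<in> U \<Longrightarrow> f w = a" "\<And>w. w \<in> V \<Longrightarrow> f w = b"
  shows "(\<lambda>u. if u \<in> color_component G f v then f w else f u) = f(v := b)"
proof -
  have "color_component G f v = {v}"
    by (rule color_component_singleton) (use assms in auto)
  moreover have "f w = b"
    using assms(1,2,5) arcs_ends_eq disjoint by auto
  ultimately show ?thesis
    by auto
qed

lemma not_P_position_singleton:
  assumes "U = {u}" "v \<in> V" "f u = a" "\<And>w. w \<in> V \<Longrightarrow> f w = b" "a \<noteq> b"
  shows "\<not> P_position (flag_move G) f"
proof (rule not_P_positionI)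
  show "flag_move G f (f(u := b))"
    using assms by (intro flag_move_singleton) auto
  show "\<not> flag_move G (f(u := b)) r" for r
    by (rule no_flag_move_monochromatic[where c = b]) (use assms verts_eq in auto)
qed

end

lemma card_ge_2_obtain_other:
  assumes "2 \<le> card A"
  obtains y where "y \<in> A" "y \<noteq> x"
proof -
  have "\<not> A \<subseteq> {x}"
    using assms card_mono[of "{x}" A] by auto
  then show ?thesis
    using that by blast
qed

theorem theorem5:
  fixes G :: "('a, 'b) pre_digraph" and f :: "'a \<Rightarrow> 'c" and m n :: nat
  assumes "m \<ge> 1" and "n \<ge> 1"
    and "complete_bipartite_digraph m n G"
    and "properly_two_colored G f"
  shows "P_position (flag_move G) f \<longleftrightarrow> m \<ge> 2 \<and> n \<ge> 2"
proof -
  obtain U V where G: "verts G = U \<union> V" "U \<inter> V = {}" "arcs_ends G = U \<times> V \<union> V \<times> U"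
    and card: "card U = m" "card V = n"
    using assms(3) unfolding complete_bipartite_digraph_def by blast
  interpret UV: complete_bipartite G U V
    using G by unfold_locales
  interpret VU: complete_bipartite G V U
    by (rule UV.swap)
  obtain u v where u: "u \<in> U" and v: "v \<in> V"
    using assms(1,2) card by fastforce
  obtain a b where ab: "a \<noteq> b" and fU: "\<And>w. w \<in> U \<Longrightarrow> f w = a" and fV: "\<And>w. w \<in> V \<Longrightarrow> f w = b"
  proof -
    have proper: "f x \<noteq> f y" if "x \<in> U" "y \<in> V" for x y
      using assms(4) that G(3) unfolding properly_two_colored_def by blast
    \<comment> \<open>There are only two colors, and all vertices of one part avoid the color of a
      fixed vertex in the other part, so they agree.\<close>
    have "card (f ` (U \<union> V)) = 2"
      using assms(4) G(1) unfolding properly_two_colored_def by simp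
    then obtain c d where cd: "f ` (U \<union> V) = {c, d}"
      by (auto simp: card_2_iff)
    have range: "f w = c \<or> f w = d" if "w \<in> U \<union> V" for w
      using cd that by blast
    show thesis
    proof (rule that)
      show "f u \<noteq> f v"
        using proper u v by blast
      show "f w = f u" if "w \<in> U" for w
        using proper[OF that v] proper[OF u v] range[of w] range[of u] range[of v] that u v by auto
      show "f w = f v" if "w \<in> V" for w
        using proper[OF u that] proper[OF u v] range[of w] range[of u] range[of v] that u v by auto
    qed
  qed
  show ?thesis
  proof
    assume P: "P_position (flag_move G) f"
    have "m \<noteq> 1"
    proof
      assume "m = 1"
      then have "U = {u}"
        using card u by (auto simp: card_1_singleton_iff)
      then show False
        using UV.not_P_position_singleton[of u v f a b] P v u ab fU fV by blast
    qed
    \<comment> \<open>Symmetric, with parts and colors exchanged.\<close>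
    moreover have "n \<noteq> 1"
    proof
      assume "n = 1"
      then have "V = {v}"
        using card v by (auto simp: card_1_singleton_iff)
      then show False
        using VU.not_P_position_singleton[of v u f b a] P u v ab fU fV by blast
    qed
    ultimately show "m \<ge> 2 \<and> n \<ge> 2"
      using assms(1,2) by linarith
  next
    assume mn: "m \<ge> 2 \<and> n \<ge> 2"
    show "P_position (flag_move G) f"
    proof (rule P_positionI)
      fix q
      assume "flag_move G f q"
      then obtain x w where x: "x \<in> verts G" "x \<rightarrow>\<^bsub>G\<^esub> w"
        and q: "q = (\<lambda>u. if u \<in> color_component G f x then f w else f u)"
        unfolding flag_move_def by blast
      consider "x \<in> U" | "x \<in> V"
        using x(1) G(1) by blast
      then show "\<exists>r. flag_move G q r \<and> (\<forall>s. \<not> flag_move G r s)"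
      proof cases
        case 1
        \<comment> \<open>\<open>y\<close> preserves color \<open>a\<close> after \<open>x\<close>
          is recolored; the reply starts from \<open>v\<close> in the opposite part.\<close>
        obtain y where "y \<in> U" "y \<noteq> x"
          using card_ge_2_obtain_other mn card by metis
        moreover have "q = f(x := b)"
          unfolding q using 1 x(2) ab fU fV by (rule UV.flag_move_from_U)
        ultimately show ?thesis
          using UV.winning_reply[of x y v a b f] 1 v ab fU fV by auto
      next
        case 2
        \<comment> \<open>Here \<open>y\<close> preserves color \<open>b\<close>, and the reply
          recolors the component of \<open>u\<close>.\<close>
        obtain y where "y \<in> V" "y \<noteq> x"
          using card_ge_2_obtain_other mn card by metis
        moreover have "q = f(x := a)"
          unfolding q using 2 x(2) ab[symmetric] fV fU by (rule VU.flag_move_from_U)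
        ultimately show ?thesis
          using VU.winning_reply[of x y u b a f] 2 u ab fU fV by auto
      qed
    qed
  qed
qed

end
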